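(* Let $\rho$ be a state of $M_n(\mathbb{C})$ with density matrix $D_\rho$ and let $\Phi : M_n(\mathbb{C}) \to M_n(\mathbb{C})$ be a unital positive $\mathrm{Tr}$-preserving linear map. Let $\lambda=(\lambda_1,\dots,\lambda_n)$ and $\mu=(\mu_1,\dots,\mu_n)$ be the eigenvalue vectors of $D_\rho$ and $\Phi(D_\rho)$, arranged in decreasing order, and let $b_\rho(\Phi)$ be the matrix associated with $\{\rho,\Phi\}$ defined in the context. Then the following are equivalent: (i) $S(\rho\circ\Phi^* ) = S(\rho)$, i.e. $S(\Phi(D_\rho)) = S(D_\rho)$. (ii) $\lambda = \mu\, b_\rho(\Phi)^T$, where $x^T$ denotes the transpose of the matrix $x$. (iii) $\lambda_i = \mu_i$ for all $i=1,\dots,n$. (iv) $\Phi(D_\rho) = u D_\rho u^*$ for some unitary $u\in M_n(\mathbb{C})$. (v) $\Phi^*\Phi(D_\rho) = D_\rho$.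
   Context: $\mathrm{Tr}$ is the standard (unnormalized) trace on $M_n(\mathbb{C})$. The density matrix $D_\rho$ of a state $\rho$ is the positive matrix with $\mathrm{Tr}(D_\rho)=1$ and $\rho(x)=\mathrm{Tr}(D_\rho x)$ for all $x\in M_n(\mathbb{C})$. Let $\eta(t)=-t\log t$ for $0<t\le 1$ and $\eta(0)=0$. The von Neumann entropy is $S(\rho)=S(D_\rho)=\sum_{i=1}^n\eta(\lambda_i)$, where $\lambda_1,\dots,\lambda_n$ are the eigenvalues of $D_\rho$ with multiplicity. A map $\Phi$ is $\mathrm{Tr}$-preserving if $\mathrm{Tr}\circ\Phi=\mathrm{Tr}$, and unital if $\Phi(1)=1$. The adjoint $\Phi^*$ is the linear map on $M_n(\mathbb{C})$ with $\mathrm{Tr}(y\,\Phi^*(x))=\mathrm{Tr}(\Phi(y)x)$ for all $x,y$; then $\rho\circ\Phi^*$ is a state with density matrix $\Phi(D_\rho)$. Let $\lambda_1\ge\dots\ge\lambda_n$ and $\mu_1\ge\dots\ge\mu_n$ be the eigenvalues of $D_\rho$ and $\Phi(D_\rho)$ (with multiplicity). Fix mutually orthogonal minimal projections $e_1,\dots,e_n$ and mutually orthogonal minimal projections $p_1,\dots,p_n$ in $M_n(\mathbb{C})$ with $D_\rho=\sum_{i=1}^n\lambda_i e_i$ and $\Phi(D_\rho)=\sum_{j=1}^n\mu_j p_j$. The matrix $b_\rho(\Phi)$ is the $n\times n$ matrix with entries $b_\rho(\Phi)_{ij}=\mathrm{Tr}(\Phi(e_i)p_j)$. Vectors are row vectors.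 *)

theory Defs
  imports
    Complex_Main
    "HOL-Library.Multiset"
    "HOL-Library.Complex_Order"
    "HOL-Computational_Algebra.Fundamental_Theorem_Algebra"
    "Jordan_Normal_Form.Char_Poly"
    "Jordan_Normal_Form.Schur_Decomposition"
begin

text \<open>
  \<open>M\<^sub>n(\<complex>)\<close> is \<^term>\<open>carrier_mat n n :: complex mat set\<close>; matrix and vector indices run
  over \<open>0, \<dots>, n - 1\<close>. Linear maps are HOL functions of which only the values on the carrier
  matter. On \<^typ>\<open>complex\<close>, \<open>0 \<le> z\<close> says that \<open>z\<close> is real and nonnegative.
\<close>

definition mat_trace :: "complex mat \<Rightarrow> complex" where
  "mat_trace A = (\<Sum>i<dim_row A. A $$ (i, i))"

definition positive_mat :: "nat \<Rightarrow> complex mat \<Rightarrow> bool" where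
  "positive_mat n A \<longleftrightarrow> A \<in> carrier_mat n n \<and> (\<forall>v\<in>carrier_vec n. 0 \<le> (A *\<^sub>v v) \<bullet>c v)"

definition unitary_mat :: "nat \<Rightarrow> complex mat \<Rightarrow> bool" where
  "unitary_mat n u \<longleftrightarrow>
     u \<in> carrier_mat n n \<and> u * mat_adjoint u = 1\<^sub>m n \<and> mat_adjoint u * u = 1\<^sub>m n"

definition projection_mat :: "nat \<Rightarrow> complex mat \<Rightarrow> bool" where
  "projection_mat n q \<longleftrightarrow> q \<in> carrier_mat n n \<and> q * q = q \<and> mat_adjoint q = q"

text \<open>For projections, \<open>q \<le> e\<close> is expressed as \<open>e * q = q\<close>.\<close>

definition minimal_projection :: "nat \<Rightarrow> complex mat \<Rightarrow> bool" where
  "minimal_projection n e \<longleftrightarrow> projection_mat n e \<and> e \<noteq> 0\<^sub>m n n \<and>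
     (\<forall>q. projection_mat n q \<and> e * q = q \<longrightarrow> q = 0\<^sub>m n n \<or> q = e)"


definition linear_functional :: "nat \<Rightarrow> (complex mat \<Rightarrow> complex) \<Rightarrow> bool" where
  "linear_functional n \<rho> \<longleftrightarrow>
     (\<forall>x\<in>carrier_mat n n. \<forall>y\<in>carrier_mat n n. \<rho> (x + y) = \<rho> x + \<rho> y) \<and>
     (\<forall>c. \<forall>x\<in>carrier_mat n n. \<rho> (c \<cdot>\<^sub>m x) = c * \<rho> x)"

definition state :: "nat \<Rightarrow> (complex mat \<Rightarrow> complex) \<Rightarrow> bool" where
  "state n \<rho> \<longleftrightarrow>
     linear_functional n \<rho> \<and> (\<forall>x. positive_mat n x \<longrightarrow> 0 \<le> \<rho> x) \<and> \<rho> (1\<^sub>m n) = 1"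

text \<open>For a state exactly one matrix has the property below.\<close>

definition density_matrix :: "nat \<Rightarrow> (complex mat \<Rightarrow> complex) \<Rightarrow> complex mat" where
  "density_matrix n \<rho> = (THE D. positive_mat n D \<and> mat_trace D = 1 \<and>
     (\<forall>x\<in>carrier_mat n n. \<rho> x = mat_trace (D * x)))"


definition linear_mat_map :: "nat \<Rightarrow> (complex mat \<Rightarrow> complex mat) \<Rightarrow> bool" where
  "linear_mat_map n \<Phi> \<longleftrightarrow>
     (\<forall>x\<in>carrier_mat n n. \<Phi> x \<in> carrier_mat n n) \<and>
     (\<forall>x\<in>carrier_mat n n. \<forall>y\<in>carrier_mat n n. \<Phi> (x + y) = \<Phi> x + \<Phi> y) \<and>
     (\<forall>c. \<forall>x\<in>carrier_mat n n. \<Phi> (c \<cdot>\<^sub>m x) = c \<cdot>\<^sub>m \<Phi> x)"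

definition positive_map :: "nat \<Rightarrow> (complex mat \<Rightarrow> complex mat) \<Rightarrow> bool" where
  "positive_map n \<Phi> \<longleftrightarrow> (\<forall>x. positive_mat n x \<longrightarrow> positive_mat n (\<Phi> x))"

definition trace_preserving :: "nat \<Rightarrow> (complex mat \<Rightarrow> complex mat) \<Rightarrow> bool" where
  "trace_preserving n \<Phi> \<longleftrightarrow> (\<forall>x\<in>carrier_mat n n. mat_trace (\<Phi> x) = mat_trace x)"

definition unital_map :: "nat \<Rightarrow> (complex mat \<Rightarrow> complex mat) \<Rightarrow> bool" where
  "unital_map n \<Phi> \<longleftrightarrow> \<Phi> (1\<^sub>m n) = 1\<^sub>m n"

text \<open>
  For a linear map \<open>\<Phi>\<close> and \<open>x\<close> in the carrier there is exactly one such \<open>z\<close>, because the trace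
  pairing is nondegenerate; it depends linearly on \<open>x\<close>.
\<close>

definition map_adjoint ::
  "nat \<Rightarrow> (complex mat \<Rightarrow> complex mat) \<Rightarrow> complex mat \<Rightarrow> complex mat" where
  "map_adjoint n \<Phi> x = (THE z. z \<in> carrier_mat n n \<and>
     (\<forall>y\<in>carrier_mat n n. mat_trace (y * z) = mat_trace (\<Phi> y * x)))"


text \<open>
  The eigenvalues, repeated according to algebraic multiplicity and in decreasing order. Intended
  for Hermitian matrices, whose eigenvalues are real, so that \<^const>\<open>Re\<close> loses nothing.
\<close>

definition eigenvalue_vec :: "complex mat \<Rightarrow> real vec" where
  "eigenvalue_vec A =
     vec_of_list (rev (sorted_list_of_multiset (image_mset Re (proots (char_poly A)))))"

definition eta :: "real \<Rightarrow> real" where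
  "eta t = (if t = 0 then 0 else - t * ln t)"

definition entropy_mat :: "complex mat \<Rightarrow> real" where
  "entropy_mat D = (\<Sum>i<dim_vec (eigenvalue_vec D). eta (eigenvalue_vec D $ i))"

definition entropy :: "nat \<Rightarrow> (complex mat \<Rightarrow> complex) \<Rightarrow> real" where
  "entropy n \<rho> = entropy_mat (density_matrix n \<rho>)"


text \<open>
  \<open>A = \<Sum>\<^sub>i l\<^sub>i e\<^sub>i\<close> with mutually orthogonal minimal projections \<open>e\<^sub>i\<close>. The sum is written
  entrywise, since \<^typ>\<open>complex mat\<close> has no zero element common to all dimensions.
\<close>

definition spectral_decomposition ::
  "nat \<Rightarrow> complex mat \<Rightarrow> real vec \<Rightarrow> (nat \<Rightarrow> complex mat) \<Rightarrow> bool" where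
  "spectral_decomposition n A l e \<longleftrightarrow>
     (\<forall>i<n. minimal_projection n (e i)) \<and>
     (\<forall>i<n. \<forall>j<n. i \<noteq> j \<longrightarrow> e i * e j = 0\<^sub>m n n) \<and>
     A = mat n n (\<lambda>(r, s). \<Sum>i<n. complex_of_real (l $ i) * e i $$ (r, s))"

definition b_matrix ::
  "nat \<Rightarrow> (complex mat \<Rightarrow> complex mat) \<Rightarrow> (nat \<Rightarrow> complex mat) \<Rightarrow> (nat \<Rightarrow> complex mat)
     \<Rightarrow> complex mat" where
  "b_matrix n \<Phi> e p = mat n n (\<lambda>(i, j). mat_trace (\<Phi> (e i) * p j))"

text \<open>A real vector as a complex matrix with one row.\<close>

definition row_vector :: "real vec \<Rightarrow> complex mat" where
  "row_vector v = mat_of_row (map_vec complex_of_real v)"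

end

theory Submission
  imports Defs
begin

text \<open>
  The matrix \<open>b\<close> is doubly stochastic and \<open>\<mu> = \<lambda> b\<close>. The conditions (i) and (ii), in combination
  with this relation, both force \<open>\<lambda>\<^sub>i = \<mu>\<^sub>j\<close> whenever \<open>b\<^sub>i\<^sub>j \<noteq> 0\<close>: (i) by the equality case of
  Jensen's inequality for the strictly concave function \<open>\<eta>\<close>, and (ii) because
  \<open>\<Sum>\<^sub>i\<^sub>j b\<^sub>i\<^sub>j (\<lambda>\<^sub>i - \<mu>\<^sub>j)\<^sup>2 = 0\<close>. Call this the support condition. It implies (ii) at once, and
  \<open>\<Sum>\<^sub>i f (\<lambda>\<^sub>i) = \<Sum>\<^sub>i\<^sub>j b\<^sub>i\<^sub>j f (\<lambda>\<^sub>i) = \<Sum>\<^sub>j f (\<mu>\<^sub>j)\<close> for every \<open>f\<close>, so that the two spectra agree with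
  multiplicities, which is (iii). For (v), apply the Cauchy-Schwarz inequality to the positive
  functional \<open>\<psi>\<^sub>j(x) = Tr (\<Phi>(x) p\<^sub>j)\<close>: if \<open>b\<^sub>i\<^sub>j = \<psi>\<^sub>j(e\<^sub>i) = 0\<close>, then \<open>\<psi>\<^sub>j(y e\<^sub>i) = 0\<close> for all \<open>y\<close>; hence
  \<open>\<mu>\<^sub>j \<psi>\<^sub>j(y e\<^sub>i) = \<lambda>\<^sub>i \<psi>\<^sub>j(y e\<^sub>i)\<close> for all \<open>i\<close>, \<open>j\<close>, and summation gives
  \<open>Tr (\<Phi>(y) \<Phi>(D)) = Tr (y D)\<close>. Conversely, pairing (v) with \<open>e\<^sub>i\<close> yields (ii). Finally (iii) and (iv)
  are equivalent by unitary diagonalization.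
\<close>

section \<open>Traces and positive matrices\<close>

lemma mat_adjoint_carrier [simp]: "A \<in> carrier_mat n m \<Longrightarrow> mat_adjoint A \<in> carrier_mat m n"
  unfolding mat_adjoint_def by (auto simp: mat_of_rows_def)

lemma mat_adjoint_dim [simp]:
  "dim_row (mat_adjoint A) = dim_col A" "dim_col (mat_adjoint A) = dim_row A"
  unfolding mat_adjoint_def by (auto simp: mat_of_rows_def)

lemma mat_adjoint_index [simp]:
  fixes A :: "complex mat"
  assumes "i < dim_col A" "j < dim_row A"
  shows "mat_adjoint A $$ (i, j) = cnj (A $$ (j, i))"
  using assms unfolding mat_adjoint_def by (auto simp: mat_of_rows_def)

lemma mult_mat_index:
  assumes "A \<in> carrier_mat n m" "B \<in> carrier_mat m k" "i < n" "j < k"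
  shows "(A * B) $$ (i, j) = (\<Sum>l<m. A $$ (i, l) * B $$ (l, j))"
  using assms by (auto simp: scalar_prod_def atLeast0LessThan intro!: sum.cong)

lemma mat_trace_carrier: "A \<in> carrier_mat n n \<Longrightarrow> mat_trace A = (\<Sum>i<n. A $$ (i, i))"
  by (auto simp: mat_trace_def)

lemma mat_trace_mult:
  assumes "A \<in> carrier_mat n n" "B \<in> carrier_mat n n"
  shows "mat_trace (A * B) = (\<Sum>i<n. \<Sum>j<n. A $$ (i, j) * B $$ (j, i))"
  unfolding mat_trace_carrier[OF mult_carrier_mat[OF assms]]
  by (intro sum.cong refl mult_mat_index[OF assms]) auto

lemma mat_trace_comm:
  assumes "A \<in> carrier_mat n n" "B \<in> carrier_mat n n"
  shows "mat_trace (A * B) = mat_trace (B * A)"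
  unfolding mat_trace_mult[OF assms] mat_trace_mult[OF assms(2,1)]
  by (subst sum.swap) (simp add: mult.commute)

lemma mat_trace_add:
  "A \<in> carrier_mat n n \<Longrightarrow> B \<in> carrier_mat n n \<Longrightarrow> mat_trace (A + B) = mat_trace A + mat_trace B"
  by (simp add: mat_trace_def sum.distrib)

lemma mat_trace_smult: "A \<in> carrier_mat n n \<Longrightarrow> mat_trace (c \<cdot>\<^sub>m A) = c * mat_trace A"
  by (simp add: mat_trace_def sum_distrib_left)

section \<open>Quadratic forms and rank-one matrices\<close>

lemma sesquilinear_form_sum:
  fixes A :: "complex mat"
  assumes "A \<in> carrier_mat n n" "v \<in> carrier_vec n"
  shows "(A *\<^sub>v v) \<bullet>c v = (\<Sum>i<n. \<Sum>j<n. A $$ (i, j) * (v $ j * cnj (v $ i)))"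
  using assms
  by (auto simp: scalar_prod_def atLeast0LessThan sum_distrib_right mult.assoc intro!: sum.cong)

text \<open>The rank-one operator v v^*. It serves as a test element for positivity and as the
  normal form of a minimal projection.\<close>

definition outer :: "complex vec \<Rightarrow> complex mat" where
  "outer v = mat (dim_vec v) (dim_vec v) (\<lambda>(r, s). v $ r * cnj (v $ s))"

lemma outer_carrier [simp]: "v \<in> carrier_vec n \<Longrightarrow> outer v \<in> carrier_mat n n"
  by (auto simp: outer_def)

lemma outer_index: "v \<in> carrier_vec n \<Longrightarrow> r < n \<Longrightarrow> s < n \<Longrightarrow> outer v $$ (r, s) = v $ r * cnj (v $ s)"
  by (auto simp: outer_def)

lemma trace_mult_outer:
  assumes "A \<in> carrier_mat n n" "v \<in> carrier_vec n"
  shows "mat_trace (A * outer v) = (A *\<^sub>v v) \<bullet>c v"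
  using assms by (simp add: mat_trace_mult[of _ n] sesquilinear_form_sum[of _ n] outer_index)

lemma cnj_mult_nonneg: "0 \<le> cnj z * z"
  by (simp add: less_eq_complex_def)

text \<open>The form at \<open>v\<close> is the squared norm of x v, written in coordinates as a sum
  of terms \<open>cnj z * z\<close>.\<close>

lemma positive_mat_adjoint_mult:
  assumes x: "x \<in> carrier_mat n n"
  shows "positive_mat n (mat_adjoint x * x)"
proof -
  have "0 \<le> ((mat_adjoint x * x) *\<^sub>v v) \<bullet>c v" if v: "v \<in> carrier_vec n" for v
  proof -
    have "((mat_adjoint x * x) *\<^sub>v v) \<bullet>c v
        = (\<Sum>i<n. \<Sum>j<n. \<Sum>l<n. cnj (x $$ (l, i) * v $ i) * (x $$ (l, j) * v $ j))"
      unfolding sesquilinear_form_sum[OF mult_carrier_mat[OF mat_adjoint_carrier[OF x] x] v]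
      using x
      by (simp add: mult_mat_index[of _ n n] sum_distrib_left sum_distrib_right mult_ac
          del: index_mult_mat)
    also have "\<dots> = (\<Sum>i<n. \<Sum>l<n. \<Sum>j<n. cnj (x $$ (l, i) * v $ i) * (x $$ (l, j) * v $ j))"
      by (rule sum.cong[OF refl], rule sum.swap)
    also have "\<dots> = (\<Sum>l<n. \<Sum>i<n. \<Sum>j<n. cnj (x $$ (l, i) * v $ i) * (x $$ (l, j) * v $ j))"
      by (rule sum.swap)
    also have "\<dots> = (\<Sum>l<n. cnj (\<Sum>i<n. x $$ (l, i) * v $ i) * (\<Sum>j<n. x $$ (l, j) * v $ j))"
      by (simp add: sum_product)
    also have "0 \<le> \<dots>"
      by (intro sum_nonneg cnj_mult_nonneg)
    finally show ?thesis .
  qed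
  then show ?thesis
    using mult_carrier_mat[OF mat_adjoint_carrier[OF x] x] by (simp add: positive_mat_def)
qed

lemma positive_mat_outer:
  assumes v: "v \<in> carrier_vec n"
  shows "positive_mat n (outer v)"
proof -
  have "0 \<le> (outer v *\<^sub>v w) \<bullet>c w" if w: "w \<in> carrier_vec n" for w
  proof -
    have "(outer v *\<^sub>v w) \<bullet>c w = (\<Sum>i<n. \<Sum>j<n. cnj (cnj (v $ i) * w $ i) * (cnj (v $ j) * w $ j))"
      using v w by (simp add: sesquilinear_form_sum[of _ n] outer_index mult_ac)
    also have "\<dots> = cnj (\<Sum>i<n. cnj (v $ i) * w $ i) * (\<Sum>j<n. cnj (v $ j) * w $ j)"
      by (simp add: sum_product)
    finally show ?thesis using cnj_mult_nonneg by presburger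
  qed
  then show ?thesis using v by (simp add: positive_mat_def)
qed

section \<open>Linear functionals and the trace pairing\<close>

lemma linear_functional_add:
  "linear_functional n f \<Longrightarrow> x \<in> carrier_mat n n \<Longrightarrow> y \<in> carrier_mat n n \<Longrightarrow> f (x + y) = f x + f y"
  by (simp add: linear_functional_def)

lemma linear_functional_smult:
  "linear_functional n f \<Longrightarrow> x \<in> carrier_mat n n \<Longrightarrow> f (c \<cdot>\<^sub>m x) = c * f x"
  by (simp add: linear_functional_def)

text \<open>Linear combinations are written entrywise, as in \<open>spectral_decomposition\<close>.
  The index set is arbitrary because both \<open>{..<n}\<close> and pairs of indices occur.\<close>

lemma linear_functional_sum:
  assumes f: "linear_functional n f" and "finite I" and E: "\<And>i. i \<in> I \<Longrightarrow> E i \<in> carrier_mat n n"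
  shows "f (mat n n (\<lambda>(r, s). \<Sum>i\<in>I. c i * E i $$ (r, s))) = (\<Sum>i\<in>I. c i * f (E i))"
  using assms(2) E
proof (induction I)
  case empty
  \<comment> \<open>The empty sum is 0 times a matrix, so homogeneity gives the value 0.\<close>
  have "mat n n (\<lambda>_. 0 :: complex) = 0 \<cdot>\<^sub>m 0\<^sub>m n n" by (rule eq_matI) auto
  then show ?case using linear_functional_smult[OF f, of "0\<^sub>m n n" 0] by simp
next
  case (insert i I)
  have eq: "mat n n (\<lambda>(r, s). \<Sum>i\<in>insert i I. c i * E i $$ (r, s))
      = c i \<cdot>\<^sub>m E i + mat n n (\<lambda>(r, s). \<Sum>i\<in>I. c i * E i $$ (r, s))"
    using insert.prems[of i] by (intro eq_matI) (auto simp: insert.hyps)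
  show ?case
    unfolding eq using insert by (simp add: case_prod_unfold linear_functional_add[OF f] linear_functional_smult[OF f])
qed

text \<open>The matrix unit E_rs, not the identity matrix.\<close>

definition unit_mat :: "nat \<Rightarrow> nat \<Rightarrow> nat \<Rightarrow> complex mat" where
  "unit_mat n r s = mat n n (\<lambda>(a, b). if a = r \<and> b = s then 1 else 0)"

lemma unit_mat_carrier [simp]: "unit_mat n r s \<in> carrier_mat n n"
  by (simp add: unit_mat_def)

lemma trace_mult_unit_mat:
  assumes "A \<in> carrier_mat n n" "r < n" "s < n"
  shows "mat_trace (A * unit_mat n r s) = A $$ (s, r)"
proof -
  have "mat_trace (A * unit_mat n r s)
      = (\<Sum>i<n. \<Sum>j<n. if i = s then (if j = r then A $$ (s, r) else 0) else 0)"
    using assms by (auto simp: mat_trace_mult[of _ n] unit_mat_def intro!: sum.cong)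
  also have "\<dots> = (\<Sum>i<n. if i = s then \<Sum>j<n. if j = r then A $$ (s, r) else 0 else 0)"
    by (rule sum.cong) auto
  finally show ?thesis using assms by simp
qed

text \<open>Testing against the matrix units recovers every entry.\<close>

lemma trace_pairing_nondegenerate:
  assumes "A \<in> carrier_mat n n" "B \<in> carrier_mat n n"
    and "\<And>x. x \<in> carrier_mat n n \<Longrightarrow> mat_trace (A * x) = mat_trace (B * x)"
  shows "A = B"
proof (rule eq_matI)
  fix i j assume "i < dim_row B" "j < dim_col B"
  then show "A $$ (i, j) = B $$ (i, j)"
    using assms(3)[of "unit_mat n j i"] assms(1,2) trace_mult_unit_mat[of _ n j i] by auto
qed (use assms in auto)

lemma linear_functional_representation:
  assumes f: "linear_functional n f"
  obtains Z where "Z \<in> carrier_mat n n" "\<And>x. x \<in> carrier_mat n n \<Longrightarrow> f x = mat_trace (Z * x)"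
proof
  \<comment> \<open>The indices are swapped because pairing with E_rs reads off the entry (s,
    r).\<close>
  let ?Z = "mat n n (\<lambda>(s, r). f (unit_mat n r s))"
  show "?Z \<in> carrier_mat n n" by simp
  fix x :: "complex mat" assume x: "x \<in> carrier_mat n n"
  let ?I = "{..<n} \<times> {..<n}"
  have "x = mat n n (\<lambda>(a, b). \<Sum>(r, s)\<in>?I. x $$ (r, s) * unit_mat n r s $$ (a, b))"
  proof (rule eq_matI; clarsimp)
    fix a b assume ab: "a < n" "b < n"
    have "(\<Sum>(r, s)\<in>?I. x $$ (r, s) * unit_mat n r s $$ (a, b))
        = (\<Sum>rs\<in>?I. if rs = (a, b) then x $$ (a, b) else 0)"
      using ab by (intro sum.cong) (auto simp: unit_mat_def split: if_splits)
    also have "\<dots> = x $$ (a, b)" using ab by simp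
    finally show "x $$ (a, b) = (\<Sum>(r, s)\<in>?I. x $$ (r, s) * unit_mat n r s $$ (a, b))" ..
  qed (use x in auto)
  then have "f x = f (mat n n (\<lambda>(a, b). \<Sum>i\<in>?I. x $$ i * (case i of (r, s) \<Rightarrow> unit_mat n r s) $$ (a, b)))"
    by (auto intro!: arg_cong[where f = f] simp: case_prod_unfold)
  also have "\<dots> = (\<Sum>i\<in>?I. x $$ i * f (case i of (r, s) \<Rightarrow> unit_mat n r s))"
    by (rule linear_functional_sum[OF f]) auto
  also have "\<dots> = (\<Sum>(r, s)\<in>?I. x $$ (r, s) * f (unit_mat n r s))"
    by (intro sum.cong) auto
  also have "\<dots> = (\<Sum>r<n. \<Sum>s<n. x $$ (r, s) * f (unit_mat n r s))"
    by (simp add: sum.cartesian_product)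
  also have "\<dots> = mat_trace (x * ?Z)"
    using x by (simp add: mat_trace_mult[of _ n])
  finally show "f x = mat_trace (?Z * x)" using x by (simp add: mat_trace_comm[of _ n])
qed

lemma linear_functional_trace_mult_left:
  assumes "linear_mat_map n \<Phi>" "y \<in> carrier_mat n n"
  shows "linear_functional n (\<lambda>x. mat_trace (\<Phi> x * y))"
proof -
  have "mat_trace ((A + B) * y) = mat_trace (A * y) + mat_trace (B * y)"
    if "A \<in> carrier_mat n n" "B \<in> carrier_mat n n" for A B
    using that assms(2) by (simp add: add_mult_distrib_mat[of _ n n _ _ n]
        mat_trace_add[OF mult_carrier_mat[of A n n y n] mult_carrier_mat[of B n n y n]])
  moreover have "mat_trace ((c \<cdot>\<^sub>m A) * y) = c * mat_trace (A * y)"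
    if "A \<in> carrier_mat n n" for A c
    using that assms(2) by (simp add: mult_smult_assoc_mat[of _ n n _ n]
        mat_trace_smult[OF mult_carrier_mat[of A n n y n]])
  ultimately show ?thesis
    using assms(1) by (simp add: linear_functional_def linear_mat_map_def)
qed

section \<open>Adjoint maps and density matrices\<close>

lemma linear_mat_map_id: "linear_mat_map n (\<lambda>x. x)"
  by (simp add: linear_mat_map_def)

lemma linear_mat_map_carrier: "linear_mat_map n \<Phi> \<Longrightarrow> x \<in> carrier_mat n n \<Longrightarrow> \<Phi> x \<in> carrier_mat n n"
  by (simp add: linear_mat_map_def)

text \<open>Nondegeneracy of the trace pairing gives uniqueness, so testing against all
  \<open>y\<close> identifies the value of the adjoint.\<close>

lemma map_adjoint_eqI:
  assumes "z \<in> carrier_mat n n"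
    and "\<And>y. y \<in> carrier_mat n n \<Longrightarrow> mat_trace (y * z) = mat_trace (\<Phi> y * x)"
  shows "map_adjoint n \<Phi> x = z"
  unfolding map_adjoint_def
proof (rule the_equality)
  fix z' assume z': "z' \<in> carrier_mat n n \<and>
    (\<forall>y\<in>carrier_mat n n. mat_trace (y * z') = mat_trace (\<Phi> y * x))"
  show "z' = z"
    using z' assms by (intro trace_pairing_nondegenerate[of _ n]) (auto simp: mat_trace_comm[of _ n])
qed (use assms in auto)

text \<open>Existence: the functional sending \<open>y\<close> to the trace of
  \<open>\<Phi> y * x\<close> is linear, and its representing matrix is the required value.\<close>

lemma map_adjoint_trace:
  assumes \<Phi>: "linear_mat_map n \<Phi>" and x: "x \<in> carrier_mat n n"
  shows "map_adjoint n \<Phi> x \<in> carrier_mat n n"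
    and "y \<in> carrier_mat n n \<Longrightarrow> mat_trace (y * map_adjoint n \<Phi> x) = mat_trace (\<Phi> y * x)"
proof -
  obtain z where z: "z \<in> carrier_mat n n"
    and *: "\<And>y. y \<in> carrier_mat n n \<Longrightarrow> mat_trace (\<Phi> y * x) = mat_trace (z * y)"
    using linear_functional_representation[OF linear_functional_trace_mult_left[OF \<Phi> x]] by blast
  have "map_adjoint n \<Phi> x = z"
    using z * by (intro map_adjoint_eqI) (auto simp: mat_trace_comm[of _ n])
  then show "map_adjoint n \<Phi> x \<in> carrier_mat n n"
    and "y \<in> carrier_mat n n \<Longrightarrow> mat_trace (y * map_adjoint n \<Phi> x) = mat_trace (\<Phi> y * x)"
    using z * by (auto simp: mat_trace_comm[of _ n])
qed

lemma density_matrix_eqI: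
  assumes "positive_mat n D" "mat_trace D = 1"
    and "\<And>x. x \<in> carrier_mat n n \<Longrightarrow> \<rho> x = mat_trace (D * x)"
  shows "density_matrix n \<rho> = D"
  unfolding density_matrix_def
proof (rule the_equality)
  fix D' assume "positive_mat n D' \<and> mat_trace D' = 1 \<and> (\<forall>x\<in>carrier_mat n n. \<rho> x = mat_trace (D' * x))"
  then show "D' = D"
    using assms by (intro trace_pairing_nondegenerate[of _ n]) (auto simp: positive_mat_def)
qed (use assms in auto)

text \<open>Linearity provides a representing matrix. Its quadratic form at \<open>v\<close> is the
  value of \<open>\<rho>\<close> at v v^*, hence nonnegative, and its trace is the value of
  \<open>\<rho>\<close> at the identity.\<close>

lemma density_matrix_state:
  assumes \<rho>: "state n \<rho>"
  shows "positive_mat n (density_matrix n \<rho>)" "mat_trace (density_matrix n \<rho>) = 1"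
    and "x \<in> carrier_mat n n \<Longrightarrow> \<rho> x = mat_trace (density_matrix n \<rho> * x)"
proof -
  obtain D where D: "D \<in> carrier_mat n n"
    and *: "\<And>x. x \<in> carrier_mat n n \<Longrightarrow> \<rho> x = mat_trace (D * x)"
    using linear_functional_representation \<rho> unfolding state_def by blast
  have pos: "positive_mat n D"
    unfolding positive_mat_def
  proof (intro conjI ballI D)
    fix v :: "complex vec" assume v: "v \<in> carrier_vec n"
    have "0 \<le> \<rho> (outer v)" using \<rho> positive_mat_outer[OF v] by (auto simp: state_def)
    then show "0 \<le> (D *\<^sub>v v) \<bullet>c v" using D v by (simp add: * trace_mult_outer[of _ n])
  qed
  have tr: "mat_trace D = 1" using \<rho> D *[of "1\<^sub>m n"] by (simp add: state_def)
  have "density_matrix n \<rho> = D" by (rule density_matrix_eqI[OF pos tr *])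
  then show "positive_mat n (density_matrix n \<rho>)" "mat_trace (density_matrix n \<rho>) = 1"
    and "x \<in> carrier_mat n n \<Longrightarrow> \<rho> x = mat_trace (density_matrix n \<rho> * x)"
    using pos tr * by auto
qed

section \<open>Null projections of positive functionals\<close>

lemma mat_adjoint_mat_adjoint [simp]: "mat_adjoint (mat_adjoint A) = (A :: complex mat)"
  by (rule eq_matI) auto

lemma mat_adjoint_mult:
  fixes A B :: "complex mat"
  assumes "A \<in> carrier_mat n m" "B \<in> carrier_mat m k"
  shows "mat_adjoint (A * B) = mat_adjoint B * mat_adjoint A"
proof (rule eq_matI)
  fix i j assume "i < dim_row (mat_adjoint B * mat_adjoint A)" "j < dim_col (mat_adjoint B * mat_adjoint A)"
  then have ij: "i < k" "j < n" using assms by auto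
  then have "mat_adjoint (A * B) $$ (i, j) = cnj ((A * B) $$ (j, i))"
    using assms by (intro mat_adjoint_index) auto
  also have "\<dots> = (\<Sum>l<m. cnj (A $$ (j, l) * B $$ (l, i)))"
    unfolding mult_mat_index[OF assms ij(2,1)] by simp
  also have "\<dots> = (mat_adjoint B * mat_adjoint A) $$ (i, j)"
    unfolding mult_mat_index[OF mat_adjoint_carrier[OF assms(2)] mat_adjoint_carrier[OF assms(1)] ij]
    using assms ij by (auto intro!: sum.cong)
  finally show "mat_adjoint (A * B) $$ (i, j) = (mat_adjoint B * mat_adjoint A) $$ (i, j)" .
qed (use assms in auto)

text \<open>Near 0 the linear term decides the sign, so a nonzero \<open>x\<close> would give a
  negative value at some small \<open>t\<close> of opposite sign.\<close>

lemma linear_plus_quadratic_nonneg: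
  fixes x q :: real
  assumes "\<And>t. 0 \<le> t * x + t\<^sup>2 * q"
  shows "x = 0"
proof (rule ccontr)
  assume "x \<noteq> 0"
  \<comment> \<open>As \<open>k\<close> is positive and exceeds \<open>q\<close>, the choice
    \<open>t = - x / k\<close> yields x^2 (q - k) / k^2, which is negative.\<close>
  define k where "k = \<bar>q\<bar> + 1"
  have k: "k > 0" "q < k" by (auto simp: k_def)
  have "0 \<le> (- x / k) * x + (- x / k)\<^sup>2 * q" by (rule assms)
  also have "\<dots> = x\<^sup>2 * (q - k) / k\<^sup>2"
    using k by (simp add: field_simps power2_eq_square)
  also have "\<dots> < 0"
    using k \<open>x \<noteq> 0\<close> by (intro divide_neg_pos mult_pos_neg) auto
  finally show False by simp
qed

text \<open>Real and purely imaginary \<open>c\<close> give two inequalities between real parts.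
  Since \<open>0 \<le> z\<close> also makes \<open>z\<close> real, they give two equations for
  imaginary parts as well, and together these force \<open>b = 0\<close>.\<close>

lemma hermitian_cross_terms_vanish:
  fixes a b q :: complex
  assumes *: "\<And>c. 0 \<le> c * a + cnj c * b + (c * cnj c) * q"
  shows "b = 0"
proof -
  have re: "0 \<le> t * (Re a + Re b) + t\<^sup>2 * Re q" and im: "0 = t * (Im a + Im b) + t\<^sup>2 * Im q" for t
    using *[of "complex_of_real t"] by (auto simp: less_eq_complex_def algebra_simps power2_eq_square)
  have re': "0 \<le> t * (Im b - Im a) + t\<^sup>2 * Re q" and im': "0 = t * (Re a - Re b) + t\<^sup>2 * Im q" for t
    using *[of "\<i> * complex_of_real t"] by (auto simp: less_eq_complex_def algebra_simps power2_eq_square)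
  have "Re a + Re b = 0" "Im b - Im a = 0"
    by (rule linear_plus_quadratic_nonneg, fact re, rule linear_plus_quadratic_nonneg, fact re')
  \<comment> \<open>Opposite values of \<open>t\<close> separate the linear from the quadratic
    coefficient.\<close>
  moreover have "Im a + Im b = 0" "Re a - Re b = 0"
    using im[of 1] im[of "-1"] im'[of 1] im'[of "-1"] by auto
  ultimately show ?thesis by (simp add: complex_eq_iff)
qed

text \<open>
  Cauchy-Schwarz: evaluate \<open>f\<close> at \<open>(e + c y\<^sup>*)\<^sup>* (e + c y\<^sup>*)\<close> for all scalars \<open>c\<close>; only the cross terms
  are not of second order in \<open>c\<close>.
\<close>

lemma positive_functional_null_projection:
  assumes f: "linear_functional n f" and pos: "\<And>x. positive_mat n x \<Longrightarrow> 0 \<le> f x"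
    and e: "projection_mat n e" "f e = 0" and y: "y \<in> carrier_mat n n"
  shows "f (y * e) = 0"
proof (rule hermitian_cross_terms_vanish)
  fix c
  let ?y = "mat_adjoint y"
  have E: "e \<in> carrier_mat n n" "e * e = e" "mat_adjoint e = e"
    using e by (auto simp: projection_mat_def)
  have Y: "?y \<in> carrier_mat n n" using y by simp
  have adj: "mat_adjoint (e + c \<cdot>\<^sub>m ?y) = e + cnj c \<cdot>\<^sub>m y"
  proof (rule eq_matI)
    fix i j assume "i < dim_row (e + cnj c \<cdot>\<^sub>m y)" "j < dim_col (e + cnj c \<cdot>\<^sub>m y)"
    then have ij: "i < n" "j < n" using y by auto
    have "mat_adjoint e $$ (i, j) = e $$ (i, j)" by (simp only: E)
    then show "mat_adjoint (e + c \<cdot>\<^sub>m ?y) $$ (i, j) = (e + cnj c \<cdot>\<^sub>m y) $$ (i, j)"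
      using ij E(1) y by auto
  qed (use E y in auto)
  have prods: "e * ?y \<in> carrier_mat n n" "y * e \<in> carrier_mat n n" "y * ?y \<in> carrier_mat n n"
    using E(1) y Y by (auto intro: mult_carrier_mat)
  have smult2: "a \<cdot>\<^sub>m (b \<cdot>\<^sub>m M) = (a * b) \<cdot>\<^sub>m M" for a b :: complex and M
    by (rule eq_matI) auto
  have "(e + cnj c \<cdot>\<^sub>m y) * (e + c \<cdot>\<^sub>m ?y)
      = e + c \<cdot>\<^sub>m (e * ?y) + (cnj c \<cdot>\<^sub>m (y * e) + (c * cnj c) \<cdot>\<^sub>m (y * ?y))"
    unfolding add_mult_distrib_mat[OF E(1) smult_carrier_mat[OF y] add_carrier_mat[OF smult_carrier_mat[OF Y]]]
      mult_add_distrib_mat[OF E(1) E(1) smult_carrier_mat[OF Y]]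
      mult_add_distrib_mat[OF smult_carrier_mat[OF y] E(1) smult_carrier_mat[OF Y]]
      mult_smult_distrib[OF E(1) Y] mult_smult_assoc_mat[OF y E(1)]
      mult_smult_assoc_mat[OF y smult_carrier_mat[OF Y]] mult_smult_distrib[OF y Y] smult2 E(2)
    by (simp add: mult.commute)
  then have "0 \<le> f (e + c \<cdot>\<^sub>m (e * ?y) + (cnj c \<cdot>\<^sub>m (y * e) + (c * cnj c) \<cdot>\<^sub>m (y * ?y)))"
    using pos[OF positive_mat_adjoint_mult[of "e + c \<cdot>\<^sub>m ?y" n]] E(1) Y by (simp add: adj)
  \<comment> \<open>The constant term \<open>f e\<close> is zero; only the cross terms and the
    quadratic term remain.\<close>
  also have "\<dots> = c * f (e * ?y) + cnj c * f (y * e) + (c * cnj c) * f (y * ?y)"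
    using E(1) prods e(2) by (simp add: linear_functional_add[OF f] linear_functional_smult[OF f])
  finally show "0 \<le> c * f (e * ?y) + cnj c * f (y * e) + (c * cnj c) * f (y * ?y)" .
qed

lemma linear_functional_trace_mult_right:
  assumes A: "A \<in> carrier_mat n n"
  shows "linear_functional n (\<lambda>x. mat_trace (A * x))"
  unfolding linear_functional_def
  using linear_functional_trace_mult_left[OF linear_mat_map_id A] A
  by (auto simp: linear_functional_def mat_trace_comm[of A])

lemma linear_functional_mult_left:
  assumes f: "linear_functional n f" and y: "y \<in> carrier_mat n n"
  shows "linear_functional n (\<lambda>x. f (y * x))"
  unfolding linear_functional_def
proof (intro conjI ballI allI)
  fix x z :: "complex mat" assume "x \<in> carrier_mat n n" "z \<in> carrier_mat n n"
  then show "f (y * (x + z)) = f (y * x) + f (y * z)"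
    using y mult_carrier_mat[of y n n] by (simp add: mult_add_distrib_mat[of _ n n _ n] linear_functional_add[OF f])
next
  fix c and x :: "complex mat" assume "x \<in> carrier_mat n n"
  then show "f (y * (c \<cdot>\<^sub>m x)) = c * f (y * x)"
    using y mult_carrier_mat[of y n n] by (simp add: mult_smult_distrib[of _ n n _ n] linear_functional_smult[OF f])
qed

section \<open>Spectral decompositions\<close>

lemma outer_mult_outer_index:
  assumes "v \<in> carrier_vec n" "w \<in> carrier_vec n" "r < n" "s < n"
  shows "(outer v * outer w) $$ (r, s) = v $ r * (\<Sum>l<n. cnj (v $ l) * w $ l) * cnj (w $ s)"
  unfolding mult_mat_index[OF outer_carrier[OF assms(1)] outer_carrier[OF assms(2)] assms(3,4)]
  using assms by (simp add: outer_index[of _ n] sum_distrib_left sum_distrib_right mult.assoc)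

lemma projection_mat_outer:
  assumes v: "v \<in> carrier_vec n" "(\<Sum>l<n. cnj (v $ l) * v $ l) = 1"
  shows "projection_mat n (outer v)" "outer v \<noteq> 0\<^sub>m n n"
proof -
  have idem: "outer v * outer v = outer v"
    using v by (intro eq_matI) (auto simp: outer_mult_outer_index[OF v(1) v(1)] outer_index[OF v(1)]
        outer_def[THEN arg_cong[where f = dim_row]] outer_def[THEN arg_cong[where f = dim_col]]
        simp del: index_mult_mat(1))
  show "projection_mat n (outer v)"
    unfolding projection_mat_def
    using v idem by (auto intro!: eq_matI simp: outer_def)
  have "mat_trace (outer v) = 1"
    using v by (simp add: mat_trace_carrier[of _ n] outer_index mult.commute)
  then show "outer v \<noteq> 0\<^sub>m n n"
    by (auto simp: mat_trace_def)
qed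

lemma minimal_projection_outer:
  assumes "minimal_projection n e"
  obtains v where "v \<in> carrier_vec n" "(\<Sum>l<n. cnj (v $ l) * v $ l) = 1" "e = outer v"
proof -
  have e: "e \<in> carrier_mat n n" "e * e = e" "e \<noteq> 0\<^sub>m n n"
    and min: "\<And>q. projection_mat n q \<Longrightarrow> e * q = q \<Longrightarrow> q \<noteq> 0\<^sub>m n n \<Longrightarrow> q = e"
    using assms by (auto simp: minimal_projection_def projection_mat_def)
  obtain r s where rs: "r < n" "s < n" "e $$ (r, s) \<noteq> 0"
    using e(1,3) by (metis carrier_matD eq_matI index_zero_mat)
  \<comment> \<open>A normalized nonzero column of \<open>e\<close> spans a projection below \<open>e\<close>.\<close>
  define N where "N = (\<Sum>l<n. (cmod (e $$ (l, s)))\<^sup>2)"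
  have "N > 0"
    unfolding N_def using rs by (intro sum_pos2[of _ r]) auto
  define v where "v = vec n (\<lambda>l. e $$ (l, s) / complex_of_real (sqrt N))"
  have v: "v \<in> carrier_vec n" by (simp add: v_def)
  have "cnj (v $ l) * v $ l = complex_of_real ((cmod (e $$ (l, s)))\<^sup>2 / N)" if "l < n" for l
    using that \<open>N > 0\<close> by (simp add: v_def mult.commute[of "cnj _"] complex_norm_square[symmetric] flip: of_real_mult of_real_power)
  then have "(\<Sum>l<n. cnj (v $ l) * v $ l) = complex_of_real (\<Sum>l<n. (cmod (e $$ (l, s)))\<^sup>2 / N)"
    by simp
  also have "\<dots> = 1"
    using \<open>N > 0\<close> by (simp add: N_def flip: sum_divide_distrib)
  finally have norm: "(\<Sum>l<n. cnj (v $ l) * v $ l) = 1" .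
  \<comment> \<open>Idempotence means that \<open>e\<close> fixes its own columns, hence also
    \<open>v\<close>, so v v^* lies below \<open>e\<close>.\<close>
  have ev: "(\<Sum>l<n. e $$ (a, l) * v $ l) = v $ a" if "a < n" for a
  proof -
    have "(\<Sum>l<n. e $$ (a, l) * e $$ (l, s)) = e $$ (a, s)"
      using mult_mat_index[OF e(1) e(1) that rs(2)] e(2) by simp
    then show ?thesis
      using that by (simp add: v_def sum_divide_distrib[symmetric])
  qed
  have "e * outer v = outer v"
  proof (rule eq_matI)
    fix a b assume "a < dim_row (outer v)" "b < dim_col (outer v)"
    then have ab: "a < n" "b < n" using v by (auto simp: outer_def)
    have "(e * outer v) $$ (a, b) = (\<Sum>l<n. e $$ (a, l) * v $ l) * cnj (v $ b)"
      unfolding mult_mat_index[OF e(1) outer_carrier[OF v] ab]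
      using v ab by (simp add: outer_index[of _ n] sum_distrib_right mult.assoc)
    then show "(e * outer v) $$ (a, b) = outer v $$ (a, b)"
      using ev ab v by (simp add: outer_index[of _ n])
  qed (use e v in \<open>auto simp: outer_def\<close>)
  then have "outer v = e"
    using min projection_mat_outer[OF v norm] by blast
  then show thesis using that v norm by blast
qed

definition real_diag :: "nat \<Rightarrow> real vec \<Rightarrow> complex mat" where
  "real_diag n l = mat n n (\<lambda>(i, j). if i = j then complex_of_real (l $ i) else 0)"

lemma unitary_matD:
  assumes "unitary_mat n U"
  shows "U \<in> carrier_mat n n" "U * mat_adjoint U = 1\<^sub>m n" "mat_adjoint U * U = 1\<^sub>m n"
  using assms by (auto simp: unitary_mat_def)

text \<open>Unit vectors spanning the ranges of the \<open>e i\<close> become the columns of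
  \<open>U\<close>; orthogonality of the projections makes these columns orthonormal.\<close>

lemma spectral_decomposition_unitary:
  assumes "spectral_decomposition n A l e"
  obtains U where "unitary_mat n U" "\<And>i. i < n \<Longrightarrow> e i = outer (col U i)"
    "A = U * real_diag n l * mat_adjoint U"
proof -
  have min: "\<And>i. i < n \<Longrightarrow> minimal_projection n (e i)"
    and orth: "\<And>i j. i < n \<Longrightarrow> j < n \<Longrightarrow> i \<noteq> j \<Longrightarrow> e i * e j = 0\<^sub>m n n"
    and A: "A = mat n n (\<lambda>(r, s). \<Sum>i<n. complex_of_real (l $ i) * e i $$ (r, s))"
    using assms by (auto simp: spectral_decomposition_def)
  have "\<forall>i\<in>{..<n}. \<exists>v. v \<in> carrier_vec n \<and> (\<Sum>k<n. cnj (v $ k) * v $ k) = 1 \<and> e i = outer v"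
    using minimal_projection_outer[OF min] by (metis lessThan_iff)
  then obtain v where v: "\<And>i. i < n \<Longrightarrow> v i \<in> carrier_vec n"
    and norm: "\<And>i. i < n \<Longrightarrow> (\<Sum>k<n. cnj (v i $ k) * v i $ k) = 1"
    and ev: "\<And>i. i < n \<Longrightarrow> e i = outer (v i)"
    unfolding bchoice_iff by auto
  define U where "U = mat n n (\<lambda>(r, i). v i $ r)"
  have U: "U \<in> carrier_mat n n" by (simp add: U_def)
  have col: "col U i = v i" if "i < n" for i
    using v[OF that] that by (intro eq_vecI) (auto simp: U_def)
  have inner0: "(\<Sum>k<n. cnj (v i $ k) * v j $ k) = 0" if ij: "i < n" "j < n" "i \<noteq> j" for i j
  proof -
    obtain r where r: "r < n" "v i $ r \<noteq> 0"
      using norm[OF ij(1)] by (metis (no_types, lifting) lessThan_iff mult_zero_right sum.neutral zero_neq_one)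
    obtain s where s: "s < n" "v j $ s \<noteq> 0"
      using norm[OF ij(2)] by (metis (no_types, lifting) lessThan_iff mult_zero_right sum.neutral zero_neq_one)
    \<comment> \<open>This is one entry of \<open>e i * e j\<close>. Its outer factors are nonzero
      by the choice of \<open>r\<close> and \<open>s\<close>, so the inner product must
      vanish.\<close>
    have "v i $ r * (\<Sum>k<n. cnj (v i $ k) * v j $ k) * cnj (v j $ s) = 0"
      using orth[OF ij] ij r s v by (simp add: ev flip: outer_mult_outer_index)
    then show ?thesis using r s by simp
  qed
  have UU: "mat_adjoint U * U = 1\<^sub>m n"
  proof (rule eq_matI)
    fix i j assume "i < dim_row (1\<^sub>m n :: complex mat)" "j < dim_col (1\<^sub>m n :: complex mat)"
    then have ij: "i < n" "j < n" by auto
    have "(mat_adjoint U * U) $$ (i, j) = (\<Sum>k<n. cnj (v i $ k) * v j $ k)"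
      unfolding mult_mat_index[OF mat_adjoint_carrier[OF U] U ij]
      using ij U by (auto intro!: sum.cong simp: U_def)
    then show "(mat_adjoint U * U) $$ (i, j) = 1\<^sub>m n $$ (i, j)"
      using ij norm inner0 by auto
  qed (use U in auto)
  \<comment> \<open>For square matrices a left inverse is also a right inverse.\<close>
  then have "unitary_mat n U"
    using U mat_mult_left_right_inverse[OF mat_adjoint_carrier[OF U] U] by (auto simp: unitary_mat_def)
  moreover have "e i = outer (col U i)" if "i < n" for i
    using that ev col by simp
  moreover have "A = U * real_diag n l * mat_adjoint U"
  proof (rule eq_matI)
    fix r s assume "r < dim_row (U * real_diag n l * mat_adjoint U)" "s < dim_col (U * real_diag n l * mat_adjoint U)"
    then have rs: "r < n" "s < n" using U by auto
    have R: "real_diag n l \<in> carrier_mat n n" by (simp add: real_diag_def)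
    have ud: "(U * real_diag n l) $$ (r, i) = U $$ (r, i) * l $ i" if "i < n" for i
    proof -
      have "(U * real_diag n l) $$ (r, i) = (\<Sum>k<n. if k = i then U $$ (r, i) * l $ i else 0)"
        unfolding mult_mat_index[OF U R rs(1) that]
        using that by (intro sum.cong) (auto simp: real_diag_def)
      then show ?thesis using that by simp
    qed
    have "(U * real_diag n l * mat_adjoint U) $$ (r, s) = (\<Sum>i<n. U $$ (r, i) * l $ i * cnj (U $$ (s, i)))"
      unfolding mult_mat_index[OF mult_carrier_mat[OF U R] mat_adjoint_carrier[OF U] rs]
      using rs U ud by (auto intro!: sum.cong simp del: index_mult_mat(1))
    also have "\<dots> = A $$ (r, s)"
      using rs by (auto simp: A U_def ev outer_index[OF v] intro!: sum.cong)
    finally show "A $$ (r, s) = (U * real_diag n l * mat_adjoint U) $$ (r, s)" ..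
  qed (use U in \<open>auto simp: A\<close>)
  ultimately show thesis using that by blast
qed

lemma spectral_decomposition_carrier:
  assumes "spectral_decomposition n A l e"
  shows "A \<in> carrier_mat n n" "i < n \<Longrightarrow> e i \<in> carrier_mat n n" "i < n \<Longrightarrow> projection_mat n (e i)"
  using assms by (auto simp: spectral_decomposition_def minimal_projection_def projection_mat_def)

text \<open>Taking \<open>f\<close> to be a trace pairing, composed with \<open>\<Phi>\<close> where
  needed, replaces sums of matrices by sums of scalars.\<close>

lemma spectral_decomposition_functional:
  assumes A: "spectral_decomposition n A l e" and f: "linear_functional n f"
  shows "f A = (\<Sum>i<n. complex_of_real (l $ i) * f (e i))"
proof -
  have "A = mat n n (\<lambda>(r, s). \<Sum>i<n. complex_of_real (l $ i) * e i $$ (r, s))"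
    using A by (simp add: spectral_decomposition_def)
  then show ?thesis
    using linear_functional_sum[OF f, of "{..<n}" e] spectral_decomposition_carrier[OF A] by auto
qed

text \<open>The \<open>e i\<close> sum to the identity, whatever the coefficients \<open>l\<close>:
  entrywise this is the relation U U^* = 1.\<close>

lemma spectral_decomposition_resolution:
  assumes A: "spectral_decomposition n A l e" and f: "linear_functional n f"
  shows "(\<Sum>i<n. f (e i)) = f (1\<^sub>m n)"
proof -
  obtain U where U: "unitary_mat n U" and e: "\<And>i. i < n \<Longrightarrow> e i = outer (col U i)"
    using spectral_decomposition_unitary[OF A] by blast
  note UD = unitary_matD[OF U]
  have "mat n n (\<lambda>(r, s). \<Sum>i<n. 1 * e i $$ (r, s)) = 1\<^sub>m n"
  proof (rule eq_matI)
    fix r s assume "r < dim_row (1\<^sub>m n :: complex mat)" "s < dim_col (1\<^sub>m n :: complex mat)"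
    then have rs: "r < n" "s < n" by auto
    then have "(\<Sum>i<n. 1 * e i $$ (r, s)) = (U * mat_adjoint U) $$ (r, s)"
      unfolding mult_mat_index[OF UD(1) mat_adjoint_carrier[OF UD(1)] rs]
      using UD(1) by (auto intro!: sum.cong simp: e outer_def)
    then show "mat n n (\<lambda>(r, s). \<Sum>i<n. 1 * e i $$ (r, s)) $$ (r, s) = 1\<^sub>m n $$ (r, s)"
      using rs UD(2) by simp
  qed auto
  then show ?thesis
    using linear_functional_sum[OF f, of "{..<n}" e "\<lambda>_. 1"] spectral_decomposition_carrier[OF A] by auto
qed

text \<open>The projections are orthogonal and have rank one, so pairing with \<open>e j\<close>
  extracts the coefficient of index \<open>j\<close>.\<close>

lemma spectral_decomposition_trace:
  assumes A: "spectral_decomposition n A l e" and j: "j < n"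
  shows "mat_trace (e j) = 1" "mat_trace (A * e j) = complex_of_real (l $ j)"
proof -
  note carr = spectral_decomposition_carrier[OF A]
  obtain v where v: "v \<in> carrier_vec n" "(\<Sum>k<n. cnj (v $ k) * v $ k) = 1" "e j = outer v"
    using minimal_projection_outer A j unfolding spectral_decomposition_def by metis
  show tr: "mat_trace (e j) = 1"
    using v by (simp add: mat_trace_carrier[of _ n] outer_index mult.commute)
  have "mat_trace (A * e j) = (\<Sum>i<n. complex_of_real (l $ i) * mat_trace (e i * e j))"
    by (rule spectral_decomposition_functional[OF A
          linear_functional_trace_mult_left[OF linear_mat_map_id carr(2)[OF j]]])
  also have "\<dots> = (\<Sum>i<n. if i = j then complex_of_real (l $ j) else 0)"
  proof (rule sum.cong[OF refl])
    fix i assume "i \<in> {..<n}"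
    then have "e i * e j = (if i = j then e j else 0\<^sub>m n n)"
      using A j carr(3)[OF j] by (auto simp: spectral_decomposition_def projection_mat_def)
    then show "complex_of_real (l $ i) * mat_trace (e i * e j) = (if i = j then complex_of_real (l $ j) else 0)"
      using tr by (simp add: mat_trace_def)
  qed
  finally show "mat_trace (A * e j) = complex_of_real (l $ j)" using j by simp
qed

lemma spectral_decomposition_trace_nonneg:
  assumes A: "spectral_decomposition n A l e" and j: "j < n" and x: "positive_mat n x"
  shows "0 \<le> mat_trace (x * e j)"
proof -
  obtain v where "v \<in> carrier_vec n" "e j = outer v"
    using minimal_projection_outer A j unfolding spectral_decomposition_def by metis
  then show ?thesis using x by (simp add: trace_mult_outer[of _ n] positive_mat_def)
qed

lemma spectral_decomposition_positive:
  assumes A: "spectral_decomposition n A l e" and j: "j < n"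
  shows "positive_mat n (e j)"
  using minimal_projection_outer A j positive_mat_outer unfolding spectral_decomposition_def by metis

section \<open>Eigenvalue vectors\<close>

text \<open>Over the complex numbers the characteristic polynomial has, with multiplicity, as many
  roots as its degree \<open>n\<close>.\<close>

lemma dim_eigenvalue_vec:
  assumes "A \<in> carrier_mat n n"
  shows "dim_vec (eigenvalue_vec A) = n"
proof -
  have "length (sorted_list_of_multiset M) = size M" for M :: "real multiset"
    by (metis mset_sorted_list_of_multiset size_mset)
  then show ?thesis
    using degree_monic_char_poly[OF assms] by (simp add: eigenvalue_vec_def size_proots_complex)
qed

text \<open>Sorting and reversing do not change a sum over all entries, so positions can be traded
  for the multiset of eigenvalues.\<close>

lemma sum_eigenvalue_vec:
  "(\<Sum>i<dim_vec (eigenvalue_vec A). f (eigenvalue_vec A $ i))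
    = (\<Sum>x\<in>#image_mset Re (proots (char_poly A)). f x)"
proof -
  define xs where "xs = rev (sorted_list_of_multiset (image_mset Re (proots (char_poly A))))"
  have "(\<Sum>i<dim_vec (eigenvalue_vec A). f (eigenvalue_vec A $ i)) = (\<Sum>i<length xs. f (xs ! i))"
    by (simp add: eigenvalue_vec_def xs_def vec_of_list_index)
  also have "\<dots> = sum_list (map f xs)"
    by (simp add: sum_list_sum_nth atLeast0LessThan)
  also have "\<dots> = sum_mset (image_mset f (mset xs))"
    by (simp flip: sum_mset_sum_list)
  finally show ?thesis by (simp add: xs_def)
qed

lemma eigenvalue_vec_eqI:
  assumes "A \<in> carrier_mat n n" "B \<in> carrier_mat n n"
    and "\<And>f :: real \<Rightarrow> real. (\<Sum>i<n. f (eigenvalue_vec A $ i)) = (\<Sum>i<n. f (eigenvalue_vec B $ i))"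
  shows "eigenvalue_vec A = eigenvalue_vec B"
proof -
  let ?M = "\<lambda>A. image_mset Re (proots (char_poly A))"
  have "(\<Sum>x\<in>#?M A. f x) = (\<Sum>x\<in>#?M B. f x)" for f :: "real \<Rightarrow> real"
    unfolding sum_eigenvalue_vec[symmetric] dim_eigenvalue_vec[OF assms(1)] dim_eigenvalue_vec[OF assms(2)]
    by (rule assms(3))
  \<comment> \<open>With the indicator of \<open>a\<close> as test function, the sum counts the
    multiplicity of \<open>a\<close>.\<close>
  then have "(\<Sum>x\<in>#?M A. if x = a then (1::real) else 0) = (\<Sum>x\<in>#?M B. if x = a then 1 else 0)" for a
    by blast
  then have "?M A = ?M B"
    by (intro multiset_eqI) (simp add: sum_mset_delta)
  then show ?thesis by (simp add: eigenvalue_vec_def)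
qed

section \<open>Doubly stochastic matrices\<close>

text \<open>The right-hand side is the tangent to \<open>eta\<close> at \<open>y\<close>, evaluated
  at \<open>x\<close>; strict concavity allows contact only at \<open>y\<close>.\<close>

lemma eta_tangent:
  assumes "0 \<le> x" "0 < y"
  shows "eta x \<le> - x * ln y - x + y" "eta x = - x * ln y - x + y \<Longrightarrow> x = y"
proof -
  have "eta x \<le> - x * ln y - x + y \<and> (eta x = - x * ln y - x + y \<longrightarrow> x = y)"
  proof (cases "x = 0")
    case True
    then show ?thesis using assms by (simp add: eta_def)
  next
    case False
    then have x: "x > 0" using assms by simp
    \<comment> \<open>With u = y / x the gap is x (u - 1 - ln u), which reduces the claim to the
      standard bound for the logarithm and its equality case.\<close>
    have gap: "- x * ln y - x + y - eta x = x * (y / x - 1 - ln (y / x))"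
      using x assms by (simp add: eta_def ln_div field_simps)
    have "ln (y / x) \<le> y / x - 1" using x assms by (intro ln_le_minus_one) simp
    then have "0 \<le> - x * ln y - x + y - eta x"
      unfolding gap using x by (intro mult_nonneg_nonneg) auto
    moreover have "x = y" if "- x * ln y - x + y - eta x = 0"
    proof -
      have "ln (y / x) = y / x - 1" using that x unfolding gap by simp
      then have "y / x = 1" using x assms by (intro ln_eq_minus_one) auto
      then show ?thesis using x by (simp add: field_simps)
    qed
    ultimately show ?thesis by auto
  qed
  then show "eta x \<le> - x * ln y - x + y" "eta x = - x * ln y - x + y \<Longrightarrow> x = y" by auto
qed

locale doubly_stochastic =
  fixes n :: nat and b :: "nat \<Rightarrow> nat \<Rightarrow> real"
  assumes nonneg: "i < n \<Longrightarrow> j < n \<Longrightarrow> 0 \<le> b i j"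
    and rows: "i < n \<Longrightarrow> (\<Sum>j<n. b i j) = 1"
    and cols: "j < n \<Longrightarrow> (\<Sum>i<n. b i j) = 1"
begin

lemma sum_rows: "(\<Sum>i<n. \<Sum>j<n. b i j * f i) = (\<Sum>i<n. f i)"
  by (simp add: rows flip: sum_distrib_right)

lemma sum_cols: "(\<Sum>i<n. \<Sum>j<n. b i j * f j) = (\<Sum>j<n. f j)"
  by (subst sum.swap) (simp add: cols flip: sum_distrib_right)

text \<open>Weighted by \<open>b\<close>, the two integrands agree in every term; row sums collapse
  one double sum and column sums the other.\<close>

lemma sum_eq_of_support:
  fixes x y :: "nat \<Rightarrow> real" and f :: "real \<Rightarrow> real"
  assumes "\<And>i j. i < n \<Longrightarrow> j < n \<Longrightarrow> b i j \<noteq> 0 \<Longrightarrow> x i = y j"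
  shows "(\<Sum>i<n. f (x i)) = (\<Sum>j<n. f (y j))"
proof -
  have "(\<Sum>i<n. \<Sum>j<n. b i j * f (x i)) = (\<Sum>i<n. \<Sum>j<n. b i j * f (y j))"
  proof (intro sum.cong refl)
    fix i j assume "i \<in> {..<n}" "j \<in> {..<n}"
    then show "b i j * f (x i) = b i j * f (y j)"
      using assms[of i j] by (cases "b i j = 0") auto
  qed
  then show ?thesis by (simp add: sum_rows sum_cols)
qed

lemma average_eq_of_support:
  assumes "\<And>i j. i < n \<Longrightarrow> j < n \<Longrightarrow> b i j \<noteq> 0 \<Longrightarrow> x i = y j" and i: "i < n"
  shows "x i = (\<Sum>j<n. b i j * y j)"
proof -
  have "(\<Sum>j<n. b i j * y j) = (\<Sum>j<n. b i j * x i)"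
  proof (intro sum.cong refl)
    fix j assume "j \<in> {..<n}"
    then show "b i j * y j = b i j * x i"
      using assms(1)[OF i, of j] by (cases "b i j = 0") auto
  qed
  then show ?thesis using i by (simp add: rows flip: sum_distrib_right)
qed

text \<open>The common last step of both equality arguments: nonnegative terms with sum zero all
  vanish, and a nonzero weight cancels.\<close>

lemma support_of_zero_sum:
  assumes "(\<Sum>i<n. \<Sum>j<n. b i j * g i j) = 0"
    and "\<And>i j. i < n \<Longrightarrow> j < n \<Longrightarrow> 0 \<le> b i j * g i j"
    and ij: "i < n" "j < n" "b i j \<noteq> 0"
  shows "g i j = 0"
proof -
  have "(\<Sum>j<n. b i j * g i j) = 0"
    using assms(1,2) ij(1) by (subst (asm) sum_nonneg_eq_0_iff) (auto intro!: sum_nonneg)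
  then have "b i j * g i j = 0"
    using assms(2) ij(1,2) by (subst (asm) sum_nonneg_eq_0_iff) auto
  then show ?thesis using ij by simp
qed

text \<open>Equality in Jensen's inequality: the weighted tangent gaps of \<open>eta\<close> are
  nonnegative, and equal entropies make their sum zero.\<close>

lemma support_of_entropy_eq:
  assumes x: "\<And>i. i < n \<Longrightarrow> 0 \<le> x i"
    and y: "\<And>j. j < n \<Longrightarrow> y j = (\<Sum>i<n. b i j * x i)"
    and eq: "(\<Sum>j<n. eta (y j)) = (\<Sum>i<n. eta (x i))"
    and ij: "i < n" "j < n" "b i j \<noteq> 0"
  shows "x i = y j"
proof -
  \<comment> \<open>The gap between \<open>\<eta>\<close> and its tangent at \<open>y j\<close>. Where \<open>y j = 0\<close> there is no tangent and
    \<open>ln 0 = 0\<close>, but then \<open>b i j * x i = 0\<close>.\<close>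
  define g where "g i j = - x i * ln (y j) - x i + y j - eta (x i)" for i j
  have y0: "0 \<le> y j" if "j < n" for j
    using that by (auto simp: y intro!: sum_nonneg mult_nonneg_nonneg nonneg x)
  have vanish: "b i j * x i = 0" if "i < n" "j < n" "y j = 0" for i j
    using sum_nonneg_eq_0_iff[of "{..<n}" "\<lambda>i. b i j * x i"] that y[OF that(2)] nonneg x by auto
  have "(\<Sum>i<n. \<Sum>j<n. b i j * g i j)
      = (\<Sum>j<n. - ln (y j) * (\<Sum>i<n. b i j * x i)) - (\<Sum>i<n. \<Sum>j<n. b i j * x i)
        + (\<Sum>i<n. \<Sum>j<n. b i j * y j) - (\<Sum>i<n. \<Sum>j<n. b i j * eta (x i))"
    unfolding g_def sum_distrib_left
    by (subst (2) sum.swap) (simp add: algebra_simps sum.distrib sum_subtractf sum_negf)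
  \<comment> \<open>The inner column sum is \<open>y j\<close>, and \<open>- ln (y j) * y j\<close>
    is \<open>eta (y j)\<close>, also for \<open>y j = 0\<close>, where both are 0.\<close>
  also have "\<dots> = (\<Sum>j<n. eta (y j)) - (\<Sum>i<n. \<Sum>j<n. b i j * x i) + (\<Sum>j<n. y j) - (\<Sum>i<n. eta (x i))"
    by (simp add: sum_rows sum_cols y[symmetric] eta_def) (auto intro!: sum.cong)
  also have "\<dots> = (\<Sum>j<n. y j) - (\<Sum>i<n. \<Sum>j<n. b i j * x i)"
    using eq by simp
  also have "\<dots> = 0"
    by (subst sum.swap) (simp add: y)
  finally have sum0: "(\<Sum>i<n. \<Sum>j<n. b i j * g i j) = 0" .
  have g0: "0 \<le> b i j * g i j" if "i < n" "j < n" for i j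
  proof (cases "y j = 0")
    case True
    then have "b i j * g i j = 0"
      using vanish[OF that True] by (auto simp: g_def eta_def)
    then show ?thesis by (simp only: order_refl)
  next
    case False
    then show ?thesis
      using eta_tangent(1)[OF x[OF that(1)], of "y j"] y0[OF that(2)] nonneg[OF that]
      by (auto simp: g_def intro!: mult_nonneg_nonneg)
  qed
  have gij: "g i j = 0" by (rule support_of_zero_sum[OF sum0 g0 ij])
  show ?thesis
  proof (cases "y j = 0")
    case True
    then show ?thesis using vanish[OF ij(1,2) True] ij by simp
  next
    case False
    then show ?thesis
      using eta_tangent(2)[OF x[OF ij(1)], of "y j"] y0[OF ij(2)] gij by (simp add: g_def)
  qed
qed

text \<open>The mixed sum of b_ij x_i y_j equals the sum of x_i^2 when summed by rows and that of
  y_j^2 when summed by columns. Hence the weighted sum of (x_i - y_j)^2 is zero.\<close>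

lemma support_of_mutual_average:
  assumes x: "\<And>i. i < n \<Longrightarrow> x i = (\<Sum>j<n. b i j * y j)"
    and y: "\<And>j. j < n \<Longrightarrow> y j = (\<Sum>i<n. b i j * x i)"
    and ij: "i < n" "j < n" "b i j \<noteq> 0"
  shows "x i = y j"
proof -
  have 1: "(\<Sum>i<n. \<Sum>j<n. b i j * (x i * y j)) = (\<Sum>i<n. (x i)\<^sup>2)"
  proof (rule sum.cong[OF refl])
    fix i assume "i \<in> {..<n}"
    then show "(\<Sum>j<n. b i j * (x i * y j)) = (x i)\<^sup>2"
      using x[of i, symmetric] by (simp add: power2_eq_square mult.left_commute flip: sum_distrib_left)
  qed
  have 2: "(\<Sum>i<n. \<Sum>j<n. b i j * (x i * y j)) = (\<Sum>j<n. (y j)\<^sup>2)"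
    unfolding sum.swap[of "\<lambda>i j. b i j * (x i * y j)"]
  proof (rule sum.cong[OF refl])
    fix j assume "j \<in> {..<n}"
    then show "(\<Sum>i<n. b i j * (x i * y j)) = (y j)\<^sup>2"
      using y[of j, symmetric] by (simp add: power2_eq_square flip: mult.assoc sum_distrib_right)
  qed
  have "(\<Sum>i<n. \<Sum>j<n. b i j * (x i - y j)\<^sup>2)
      = (\<Sum>i<n. \<Sum>j<n. b i j * (x i)\<^sup>2) + (\<Sum>i<n. \<Sum>j<n. b i j * (y j)\<^sup>2)
        - 2 * (\<Sum>i<n. \<Sum>j<n. b i j * (x i * y j))"
    by (simp add: power2_diff algebra_simps sum.distrib sum_subtractf sum_distrib_left)
  also have "\<dots> = 0"
    using 1 2 by (simp add: sum_rows sum_cols)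
  finally have "(x i - y j)\<^sup>2 = 0"
    by (rule support_of_zero_sum[OF _ _ ij]) (simp add: nonneg)
  then show ?thesis by simp
qed

end

section \<open>The equivalences\<close>

text \<open>Duality moves the adjoint from the argument onto \<open>\<Phi>\<close> at the density
  matrix; positivity and trace preservation of \<open>\<Phi>\<close> keep it a density
  matrix.\<close>

lemma density_matrix_comp_map_adjoint:
  assumes \<rho>: "state n \<rho>" and \<Phi>: "linear_mat_map n \<Phi>" "positive_map n \<Phi>" "trace_preserving n \<Phi>"
  shows "density_matrix n (\<rho> \<circ> map_adjoint n \<Phi>) = \<Phi> (density_matrix n \<rho>)"
proof (rule density_matrix_eqI)
  let ?D = "density_matrix n \<rho>"
  have D: "?D \<in> carrier_mat n n"
    using density_matrix_state(1)[OF \<rho>] by (simp add: positive_mat_def)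
  show "positive_mat n (\<Phi> ?D)"
    using density_matrix_state(1)[OF \<rho>] \<Phi>(2) by (simp add: positive_map_def)
  show "mat_trace (\<Phi> ?D) = 1"
    using density_matrix_state(2)[OF \<rho>] \<Phi>(3) D by (simp add: trace_preserving_def)
  fix x :: "complex mat" assume x: "x \<in> carrier_mat n n"
  show "(\<rho> \<circ> map_adjoint n \<Phi>) x = mat_trace (\<Phi> ?D * x)"
    using map_adjoint_trace[OF \<Phi>(1) x] density_matrix_state(3)[OF \<rho>] D by simp
qed

lemma eigenvalue_vec_similar:
  assumes "unitary_mat n u" "A \<in> carrier_mat n n"
  shows "eigenvalue_vec (u * A * mat_adjoint u) = eigenvalue_vec A"
proof -
  note u = unitary_matD[OF assms(1)]
  have "similar_mat_wit (u * A * mat_adjoint u) A u (mat_adjoint u)"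
    using u assms(2) by (intro similar_mat_witI[of _ _ n]) (auto intro: mult_carrier_mat)
  then have "char_poly (u * A * mat_adjoint u) = char_poly A"
    by (intro char_poly_similar) (auto simp: similar_mat_def)
  then show ?thesis by (simp add: eigenvalue_vec_def)
qed

text \<open>Both matrices are diagonalized to the same diagonal matrix, by unitaries
  \<open>U\<close> and \<open>V\<close>; then u = V U^* carries one to the other.\<close>

lemma unitarily_equivalent_of_spectral_decomposition:
  assumes A: "spectral_decomposition n A l e" and B: "spectral_decomposition n B l f"
  obtains u where "unitary_mat n u" "B = u * A * mat_adjoint u"
proof -
  obtain U where U: "unitary_mat n U" and AU: "A = U * real_diag n l * mat_adjoint U"
    using spectral_decomposition_unitary[OF A] by blast
  obtain V where V: "unitary_mat n V" and BV: "B = V * real_diag n l * mat_adjoint V"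
    using spectral_decomposition_unitary[OF B] by blast
  note U = unitary_matD[OF U] and V = unitary_matD[OF V]
  let ?U = "mat_adjoint U" and ?V = "mat_adjoint V" and ?L = "real_diag n l"
  have carr: "U \<in> carrier_mat n n" "?U \<in> carrier_mat n n" "V \<in> carrier_mat n n" "?V \<in> carrier_mat n n"
      "?L \<in> carrier_mat n n"
    using U(1) V(1) by (auto simp: real_diag_def)
  have cancel: "?U * (U * X) = X" "?V * (V * X) = X" if "X \<in> carrier_mat n n" for X
    using that U(3) V(3) assoc_mult_mat[OF carr(2,1) that, symmetric]
      assoc_mult_mat[OF carr(4,3) that, symmetric] by (simp_all del: assoc_mult_mat)
  have adj: "mat_adjoint (V * ?U) = U * ?V"
    using mat_adjoint_mult[OF carr(3,2)] by simp
  have m: "X * Y \<in> carrier_mat n n" if "X \<in> carrier_mat n n" "Y \<in> carrier_mat n n" for X Y :: "complex mat"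
    using that by (rule mult_carrier_mat)
  note assoc = assoc_mult_mat[of _ n n _ n _ n]
  have "unitary_mat n (V * ?U)"
    unfolding unitary_mat_def adj using U V carr by (simp add: m assoc cancel)
  moreover have "B = (V * ?U) * A * mat_adjoint (V * ?U)"
    unfolding adj AU BV using carr by (simp add: m assoc cancel)
  ultimately show thesis using that by blast
qed

lemma spectral_decomposition_cong:
  assumes "\<And>i. i < n \<Longrightarrow> l $ i = l' $ i"
  shows "spectral_decomposition n A l e \<longleftrightarrow> spectral_decomposition n A l' e"
  using assms unfolding spectral_decomposition_def by (auto intro!: arg_cong2[where f = "mat n"] sum.cong)

text \<open>The transpose makes row \<open>i\<close> of \<open>M\<close> the weights for entry
  \<open>i\<close>, so (ii) says that each entry of \<open>x\<close> is a weighted sum of the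
  entries of \<open>y\<close>.\<close>

lemma row_vector_eq_iff:
  assumes "dim_vec x = n" "dim_vec y = n" "M \<in> carrier_mat n n"
  shows "row_vector x = row_vector y * transpose_mat M
    \<longleftrightarrow> (\<forall>i<n. complex_of_real (x $ i) = (\<Sum>j<n. M $$ (i, j) * complex_of_real (y $ j)))"
proof -
  have carr: "row_vector y \<in> carrier_mat 1 n" "transpose_mat M \<in> carrier_mat n n"
    using assms by (auto simp: row_vector_def)
  have entry: "(row_vector y * transpose_mat M) $$ (0, i) = (\<Sum>j<n. M $$ (i, j) * complex_of_real (y $ j))"
    if "i < n" for i
    unfolding mult_mat_index[OF carr _ that, of 0, simplified]
    using that assms by (auto intro!: sum.cong simp: row_vector_def mat_of_row_def)
  have "row_vector x $$ (0, i) = complex_of_real (x $ i)" if "i < n" for i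
    using that assms by (simp add: row_vector_def mat_of_row_def)
  then show ?thesis
    using entry assms carr by (auto simp del: index_mult_mat(1) simp: mat_eq_iff row_vector_def)
qed

theorem theorem3p3:
  fixes n :: nat
    and \<rho> :: "complex mat \<Rightarrow> complex"
    and \<Phi> :: "complex mat \<Rightarrow> complex mat"
    and D :: "complex mat"
    and lam mu :: "real vec"
    and e p :: "nat \<Rightarrow> complex mat"
  assumes "state n \<rho>"
    and "D = density_matrix n \<rho>"
    and "linear_mat_map n \<Phi>"
    and "positive_map n \<Phi>"
    and "unital_map n \<Phi>"
    and "trace_preserving n \<Phi>"
    and "lam = eigenvalue_vec D"
    and "mu = eigenvalue_vec (\<Phi> D)"
    and "spectral_decomposition n D lam e"
    and "spectral_decomposition n (\<Phi> D) mu p"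
  shows "let
      P_i = (entropy n (\<rho> \<circ> map_adjoint n \<Phi>) = entropy n \<rho>);
      P_i' = (entropy_mat (\<Phi> D) = entropy_mat D);
      P_ii = (row_vector lam = row_vector mu * transpose_mat (b_matrix n \<Phi> e p));
      P_iii = (\<forall>i<n. lam $ i = mu $ i);
      P_iv = (\<exists>u. unitary_mat n u \<and> \<Phi> D = u * D * mat_adjoint u);
      P_v = (map_adjoint n \<Phi> (\<Phi> D) = D)
    in (P_i \<longleftrightarrow> P_i') \<and> (P_i \<longleftrightarrow> P_ii) \<and> (P_ii \<longleftrightarrow> P_iii) \<and> (P_iii \<longleftrightarrow> P_iv) \<and> (P_iv \<longleftrightarrow> P_v)"
proof -
  note \<rho> = assms(1) and \<Phi> = assms(3) and eD = assms(9) and pD = assms(10)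
  note \<Phi>c = linear_mat_map_carrier[OF \<Phi>]
  note ec = spectral_decomposition_carrier(2)[OF eD] and pc = spectral_decomposition_carrier(2)[OF pD]
  have pos: "positive_mat n D"
    using density_matrix_state(1)[OF \<rho>] assms(2) by simp
  have Dc: "D \<in> carrier_mat n n" and \<Phi>Dc: "\<Phi> D \<in> carrier_mat n n"
    using pos \<Phi>c by (auto simp: positive_mat_def)
  have dims: "dim_vec lam = n" "dim_vec mu = n"
    using dim_eigenvalue_vec Dc \<Phi>Dc assms(7,8) by auto
  \<comment> \<open>These positive functionals take the values b_ij on the \<open>e i\<close> and
    add up to the trace.\<close>
  define \<psi> where "\<psi> j x = mat_trace (\<Phi> x * p j)" for j x
  have \<psi>_lin: "linear_functional n (\<psi> j)" if "j < n" for j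
    unfolding \<psi>_def by (rule linear_functional_trace_mult_left[OF \<Phi> pc[OF that]])
  have \<psi>_pos: "0 \<le> \<psi> j x" if "j < n" "positive_mat n x" for j x
    unfolding \<psi>_def using that assms(4)
    by (auto intro!: spectral_decomposition_trace_nonneg[OF pD] simp: positive_map_def)
  have sum_\<psi>: "(\<Sum>j<n. \<psi> j x) = mat_trace x" if x: "x \<in> carrier_mat n n" for x
  proof -
    have "(\<Sum>j<n. \<psi> j x) = mat_trace (\<Phi> x * 1\<^sub>m n)"
      unfolding \<psi>_def
      by (rule spectral_decomposition_resolution[OF pD linear_functional_trace_mult_right[OF \<Phi>c[OF x]]])
    then show ?thesis using \<Phi>c[OF x] x assms(6) by (simp add: trace_preserving_def)
  qed
  \<comment> \<open>The values are nonnegative, hence real, so passing to real parts loses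
    nothing.\<close>
  define b where "b i j = Re (\<psi> j (e i))" for i j
  have b: "0 \<le> b i j" "\<psi> j (e i) = complex_of_real (b i j)" if "i < n" "j < n" for i j
    using \<psi>_pos[OF that(2) spectral_decomposition_positive[OF eD that(1)]]
    by (auto simp: b_def less_eq_complex_def complex_eq_iff)
  have \<psi>D: "(\<Sum>i<n. complex_of_real (lam $ i) * \<psi> j (e i)) = complex_of_real (mu $ j)" if "j < n" for j
    using spectral_decomposition_functional[OF eD \<psi>_lin[OF that]]
      spectral_decomposition_trace(2)[OF pD that] by (simp add: \<psi>_def)
  \<comment> \<open>Row sums are 1 by trace preservation, through \<open>sum_\<psi>\<close>; column
    sums are 1 because \<open>\<Phi>\<close> is unital.\<close>
  interpret doubly_stochastic n b
  proof
    fix i j assume "i < n" "j < n"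
    then show "0 \<le> b i j" by (rule b)
  next
    fix i assume i: "i < n"
    have "complex_of_real (\<Sum>j<n. b i j) = (\<Sum>j<n. \<psi> j (e i))" using i by (simp add: b)
    also have "\<dots> = 1"
      using sum_\<psi>[OF ec[OF i]] spectral_decomposition_trace(1)[OF eD i] by simp
    finally show "(\<Sum>j<n. b i j) = 1" by (simp only: of_real_eq_1_iff)
  next
    fix j assume j: "j < n"
    have "complex_of_real (\<Sum>i<n. b i j) = (\<Sum>i<n. \<psi> j (e i))" using j by (simp add: b)
    also have "\<dots> = \<psi> j (1\<^sub>m n)"
      by (rule spectral_decomposition_resolution[OF eD \<psi>_lin[OF j]])
    also have "\<dots> = 1"
      using assms(5) pc[OF j] spectral_decomposition_trace(1)[OF pD j] by (simp add: \<psi>_def unital_map_def)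
    finally show "(\<Sum>i<n. b i j) = 1" by (simp only: of_real_eq_1_iff)
  qed
  have lam_nonneg: "0 \<le> lam $ i" if "i < n" for i
    using spectral_decomposition_trace_nonneg[OF eD that pos] spectral_decomposition_trace(2)[OF eD that]
    by (simp add: less_eq_complex_def)
  have mu_avg: "mu $ j = (\<Sum>i<n. b i j * lam $ i)" if "j < n" for j
  proof -
    have "complex_of_real (\<Sum>i<n. b i j * lam $ i) = (\<Sum>i<n. complex_of_real (lam $ i) * \<psi> j (e i))"
      using that by (simp add: b mult.commute)
    then show ?thesis using \<psi>D[OF that] by (metis of_real_eq_iff)
  qed

  define supp where "supp \<longleftrightarrow> (\<forall>i<n. \<forall>j<n. b i j \<noteq> 0 \<longrightarrow> lam $ i = mu $ j)"
  define P_ii where "P_ii \<longleftrightarrow> row_vector lam = row_vector mu * transpose_mat (b_matrix n \<Phi> e p)"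

  have P_ii: "P_ii \<longleftrightarrow> (\<forall>i<n. lam $ i = (\<Sum>j<n. b i j * mu $ j))"
  proof -
    have bm: "b_matrix n \<Phi> e p \<in> carrier_mat n n" by (simp add: b_matrix_def)
    have "(\<Sum>j<n. b_matrix n \<Phi> e p $$ (i, j) * complex_of_real (mu $ j))
        = complex_of_real (\<Sum>j<n. b i j * mu $ j)" if "i < n" for i
      using that by (simp add: b_matrix_def b flip: \<psi>_def)
    then show ?thesis
      unfolding P_ii_def row_vector_eq_iff[OF dims bm] by (simp only: of_real_eq_iff cong: conj_cong imp_cong)
  qed
  have entropy: "entropy_mat D = (\<Sum>i<n. eta (lam $ i))" "entropy_mat (\<Phi> D) = (\<Sum>i<n. eta (mu $ i))"
    using dims assms(7,8) by (auto simp: entropy_mat_def)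

  have i_supp: "supp" if "entropy_mat (\<Phi> D) = entropy_mat D"
    unfolding supp_def
    using support_of_entropy_eq[of "($) lam" "($) mu", OF lam_nonneg mu_avg that[unfolded entropy]] by blast
  have ii_supp: "supp" if "P_ii"
    unfolding supp_def
    using support_of_mutual_average[of "($) lam" "($) mu", OF that[unfolded P_ii, rule_format] mu_avg] by blast
  have supp_ii: "P_ii" if "supp"
    using average_eq_of_support[of "($) lam" "($) mu"] that unfolding P_ii supp_def by blast
  have supp_iii: "\<forall>i<n. lam $ i = mu $ i" if "supp"
  proof -
    \<comment> \<open>The support condition equates the sums of every test function over both
      spectra; the decreasing order then fixes the entries.\<close>
    have "eigenvalue_vec D = eigenvalue_vec (\<Phi> D)"
      using Dc \<Phi>Dc sum_eq_of_support[of "($) lam" "($) mu"] that assms(7,8)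
      by (intro eigenvalue_vec_eqI[of _ n]) (auto simp: supp_def)
    then show ?thesis using assms(7,8) by simp
  qed
  have iii_i: "entropy_mat (\<Phi> D) = entropy_mat D" if "\<forall>i<n. lam $ i = mu $ i"
    using that by (simp add: entropy)
  have iii_iv: "\<exists>u. unitary_mat n u \<and> \<Phi> D = u * D * mat_adjoint u" if "\<forall>i<n. lam $ i = mu $ i"
  proof -
    \<comment> \<open>Equal eigenvalues let both matrices be decomposed with the same coefficient
      vector.\<close>
    have "spectral_decomposition n (\<Phi> D) lam p"
      using pD that spectral_decomposition_cong[of n lam mu] by simp
    then show ?thesis
      using unitarily_equivalent_of_spectral_decomposition[OF eD] by blast
  qed
  have iv_iii: "\<forall>i<n. lam $ i = mu $ i" if "\<exists>u. unitary_mat n u \<and> \<Phi> D = u * D * mat_adjoint u"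
    using that eigenvalue_vec_similar Dc assms(7,8) by metis
  have supp_v: "map_adjoint n \<Phi> (\<Phi> D) = D" if supp
  proof (rule map_adjoint_eqI[OF Dc])
    fix y :: "complex mat" assume y: "y \<in> carrier_mat n n"
    have yc: "y * e i \<in> carrier_mat n n" if "i < n" for i
      using y ec[OF that] by (rule mult_carrier_mat)
    have "mat_trace (\<Phi> y * \<Phi> D) = (\<Sum>j<n. complex_of_real (mu $ j) * \<psi> j y)"
      unfolding \<psi>_def
      by (rule spectral_decomposition_functional[OF pD linear_functional_trace_mult_right[OF \<Phi>c[OF y]]])
    \<comment> \<open>The identity, as the sum of the \<open>e i\<close>, is inserted to the right
      of \<open>y\<close>.\<close>
    also have "\<dots> = (\<Sum>j<n. complex_of_real (mu $ j) * (\<Sum>i<n. \<psi> j (y * e i)))"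
      using spectral_decomposition_resolution[OF eD linear_functional_mult_left[OF \<psi>_lin y]] y by simp
    also have "\<dots> = (\<Sum>j<n. \<Sum>i<n. complex_of_real (lam $ i) * \<psi> j (y * e i))"
      unfolding sum_distrib_left
    proof (intro sum.cong refl)
      fix i j assume "i \<in> {..<n}" "j \<in> {..<n}"
      then have ij: "i < n" "j < n" by auto
      \<comment> \<open>Either the support condition equates the two eigenvalues, or
        \<open>e i\<close> is a null projection of \<open>\<psi> j\<close> and both sides
        vanish.\<close>
      show "complex_of_real (mu $ j) * \<psi> j (y * e i) = complex_of_real (lam $ i) * \<psi> j (y * e i)"
      proof (cases "b i j = 0")
        case True
        then have "\<psi> j (y * e i) = 0"
          using ij b(2)[OF ij] y spectral_decomposition_carrier(3)[OF eD] \<psi>_pos[OF ij(2)]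
          by (intro positive_functional_null_projection[OF \<psi>_lin]) auto
        then show ?thesis by simp
      qed (use that ij supp_def in auto)
    qed
    also have "\<dots> = (\<Sum>i<n. complex_of_real (lam $ i) * (\<Sum>j<n. \<psi> j (y * e i)))"
      by (subst sum.swap) (simp add: sum_distrib_left)
    also have "\<dots> = (\<Sum>i<n. complex_of_real (lam $ i) * mat_trace (y * e i))"
      by (simp add: sum_\<psi> yc)
    also have "\<dots> = mat_trace (y * D)"
      by (rule spectral_decomposition_functional[OF eD linear_functional_trace_mult_right[OF y], symmetric])
    finally show "mat_trace (y * D) = mat_trace (\<Phi> y * \<Phi> D)" ..
  qed
  have v_ii: P_ii if v: "map_adjoint n \<Phi> (\<Phi> D) = D"
    unfolding P_ii
  proof (intro allI impI)
    fix i assume i: "i < n"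
    have "complex_of_real (lam $ i) = mat_trace (e i * D)"
      using spectral_decomposition_trace(2)[OF eD i] mat_trace_comm[OF Dc ec[OF i]] by simp
    \<comment> \<open>By (v), \<open>D\<close> is the adjoint applied to \<open>\<Phi> D\<close>;
      duality moves the adjoint back onto \<open>e i\<close>.\<close>
    also have "\<dots> = mat_trace (\<Phi> (e i) * \<Phi> D)"
      using map_adjoint_trace(2)[OF \<Phi> \<Phi>Dc ec[OF i]] v by simp
    also have "\<dots> = (\<Sum>j<n. complex_of_real (mu $ j) * \<psi> j (e i))"
      unfolding \<psi>_def
      by (rule spectral_decomposition_functional[OF pD linear_functional_trace_mult_right[OF \<Phi>c[OF ec[OF i]]]])
    also have "\<dots> = complex_of_real (\<Sum>j<n. b i j * mu $ j)"
      using i by (simp add: b mult.commute)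
    finally show "lam $ i = (\<Sum>j<n. b i j * mu $ j)" by (simp only: of_real_eq_iff)
  qed
  have "entropy n (\<rho> \<circ> map_adjoint n \<Phi>) = entropy n \<rho> \<longleftrightarrow> entropy_mat (\<Phi> D) = entropy_mat D"
    using density_matrix_comp_map_adjoint[OF \<rho> \<Phi> assms(4,6)] assms(2) by (simp add: entropy_def)
  \<comment> \<open>The implications proved link \<open>supp\<close> and (i) to (v) in both
    directions: (iii) returns to (i), (v) returns to (ii), and (iv) is tied to (iii).\<close>
  then show ?thesis
    unfolding Let_def P_ii_def[symmetric]
    using i_supp ii_supp supp_ii supp_iii iii_i iii_iv iv_iii supp_v v_ii by blast
qed

end
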